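(* The output $\hat{V}$ of the dynamic-programming algorithm described in the context satisfies $ (1-\delta)(1-\frac{\epsilon}{10})\hat{V} \leq OPT_{W} \leq \hat{V} $.
   Context: Setting (stochastic unbounded min-knapsack problem): there are $n$ item types; an item of type $i$ has deterministic cost $c_i$ and a random weight $X_i$ with positive integer support (the distribution is accessible through an oracle returning $D_i(j)=\Pr\{X_i\le j\}$); each type has infinite supply and all item weights are independent. A knapsack has capacity $W$; items are inserted one by one, each realized weight being revealed on insertion, until the total weight is at least $W$. Let $d_i(j)=\Pr\{X_i=j\}$, and let $OPT_w$ be the minimum expected total cost when the remaining capacity is $w$, with $OPT_w=0$ for $w\le 0$ and $OPT_w=\min_k\left(c_k+\sum_{j} d_k(j)\,OPT_{w-j}\right)$ for $w\ge 1$. Fix $\epsilon>0$. Let $T$ be an estimate satisfying $\frac14 OPT_W\le T\le OPT_W$ (concretely $T=\frac{W}{2}\min_i \frac{c_i}{\overline{E}[X_i]}$ where $\overline{E}[X_i]=\sum_j d_i(j)2^{\lfloor\log_2 j\rfloor}$). Let $\theta=\frac{\epsilon}{10n}$ and assume every type is expensive, i.e. $c_i\ge\theta T$ for all $i$. Let $\delta=\frac{\epsilon^2}{100n}$. The algorithm: set $f_0=0$. For $i=1,2,\dots,\lceil 1/\delta\rceil+1$: given $f_0,\dots,f_{i-1}$, define $g_w=j\delta T$ for $f_{j-1}<w\le f_j$ ($j\le i-1$) and $g_w=i\delta T$ for $w>f_{i-1}$; compute by binary search over $[0,W]$ $f_i=\max\left\{ w' ~\middle|~ \exists k,\ c_k+\sum_{j=1}^{w'-1}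 d_k(w'-j)\,g_j \le i\delta T\right\}$; if $f_i\ge W$, output $\hat V:=i\delta T$ and stop.
   Formalization: Assumes δ ≤ 1 (for larger ε both factors are negative and the claim can fail); as the loop up to ⌈1/δ⌉+1 may end with no output, the bounds are stated for any output it gives, and existence of the output with these bounds is shown for every sufficiently large loop bound. *)

theory Defs
  imports "HOL-Probability.Probability"
begin

section \<open>The stochastic unbounded min-knapsack problem\<close>

text \<open>
  The item types are the elements of a finite type \<open>'i\<close>, so \<open>n = CARD('i)\<close>.
  Type \<open>k\<close> has cost \<open>c k\<close> and weight distribution \<open>X k\<close>, with \<open>pmf (X k) j\<close> playing the role
  of \<open>d\<^sub>k(j)\<close>.
  A history lists the items inserted so far with their realized weights, the latest one first.
  An (adaptive) policy selects the type of the next item from the history.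
\<close>

type_synonym 'i history = "('i \<times> nat) list"
type_synonym 'i policy = "'i history \<Rightarrow> 'i"

definition total_weight :: "'i history \<Rightarrow> nat" where
  "total_weight h = (\<Sum>(k, x)\<leftarrow>h. x)"

definition total_cost :: "('i \<Rightarrow> real) \<Rightarrow> 'i history \<Rightarrow> real" where
  "total_cost c h = (\<Sum>(k, x)\<leftarrow>h. c k)"

text \<open>
  The random history after at most \<open>t\<close> insertions, where insertion stops as soon as the total
  weight is at least \<open>w\<close>. Each weight is drawn independently of everything drawn before.
\<close>

primrec insertions :: "('i \<Rightarrow> nat pmf) \<Rightarrow> 'i policy \<Rightarrow> nat \<Rightarrow> nat \<Rightarrow> 'i history pmf" where
  "insertions X \<pi> w 0 = return_pmf []"
| "insertions X \<pi> w (Suc t) =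
     bind_pmf (insertions X \<pi> w t) (\<lambda>h.
       if w \<le> total_weight h then return_pmf h
       else map_pmf (\<lambda>x. (\<pi> h, x) # h) (X (\<pi> h)))"

text \<open>
  Weights are positive integers, so at most \<open>w\<close> insertions take place; hence the horizon \<open>w\<close>
  (see \<open>insertions_stable\<close> below).
\<close>

definition expected_cost :: "('i \<Rightarrow> real) \<Rightarrow> ('i \<Rightarrow> nat pmf) \<Rightarrow> 'i policy \<Rightarrow> nat \<Rightarrow> real" where
  "expected_cost c X \<pi> w = measure_pmf.expectation (insertions X \<pi> w w) (total_cost c)"

definition OPT :: "('i \<Rightarrow> real) \<Rightarrow> ('i \<Rightarrow> nat pmf) \<Rightarrow> nat \<Rightarrow> real" where
  "OPT c X w = (INF \<pi>. expected_cost c X \<pi> w)"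


section \<open>The dynamic program\<close>

text \<open>
  In the following, \<open>s\<close> is the grid width \<open>\<delta> T\<close> and \<open>F\<close> is the list
  \<open>[f\<^sub>0, \<dots>, f\<^sub>i\<^sub>-\<^sub>1]\<close> of the thresholds computed so far, so \<open>i = length F\<close>.
\<close>

definition rounded_value :: "real \<Rightarrow> nat list \<Rightarrow> nat \<Rightarrow> real" where
  "rounded_value s F w =
     (if last F < w then real (length F)
      else real (LEAST j. 1 \<le> j \<and> j < length F \<and> F ! (j - 1) < w \<and> w \<le> F ! j)) * s"

text \<open>
  The search for the next threshold ranges over \<open>[0, W]\<close>; it returns \<open>0\<close> if no \<open>w'\<close> in this
  range qualifies.
\<close>

definition next_threshold ::
  "('i \<Rightarrow> real) \<Rightarrow> ('i \<Rightarrow> nat pmf) \<Rightarrow> nat \<Rightarrow> real \<Rightarrow> nat list \<Rightarrow> nat" where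
  "next_threshold c X W s F =
     Max (insert 0 {w' \<in> {0..W}.
       \<exists>k. c k + (\<Sum>j\<in>{1..<w'}. pmf (X k) (w' - j) * rounded_value s F j) \<le> real (length F) * s})"

primrec thresholds ::
  "('i \<Rightarrow> real) \<Rightarrow> ('i \<Rightarrow> nat pmf) \<Rightarrow> nat \<Rightarrow> real \<Rightarrow> nat \<Rightarrow> nat list" where
  "thresholds c X W s 0 = [0]"
| "thresholds c X W s (Suc i) =
     thresholds c X W s i @ [next_threshold c X W s (thresholds c X W s i)]"

definition threshold ::
  "('i \<Rightarrow> real) \<Rightarrow> ('i \<Rightarrow> nat pmf) \<Rightarrow> nat \<Rightarrow> real \<Rightarrow> nat \<Rightarrow> nat" where
  "threshold c X W s i = last (thresholds c X W s i)"

text \<open>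
  The loop \<open>i = 1, \<dots>, N\<close>; the result is \<open>None\<close> if the loop ends without reaching capacity \<open>W\<close>.
\<close>

definition dp_output ::
  "('i \<Rightarrow> real) \<Rightarrow> ('i \<Rightarrow> nat pmf) \<Rightarrow> nat \<Rightarrow> real \<Rightarrow> nat \<Rightarrow> real option" where
  "dp_output c X W s N =
     (if \<exists>i\<in>{1..N}. W \<le> threshold c X W s i
      then Some (real (LEAST i. 1 \<le> i \<and> W \<le> threshold c X W s i) * s)
      else None)"


section \<open>The recursion for the optimum\<close>

lemma total_weight_simps [simp]:
  "total_weight [] = 0"
  "total_weight ((k, x) # h) = x + total_weight h"
  "total_weight (h @ h') = total_weight h + total_weight h'"
  by (simp_all add: total_weight_def)

lemma total_cost_simps [simp]:
  "total_cost c [] = 0"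
  "total_cost c ((k, x) # h) = c k + total_cost c h"
  "total_cost c (h @ h') = total_cost c h + total_cost c h'"
  by (simp_all add: total_cost_def)

lemma insertions_weight:
  assumes "\<And>k. 0 \<notin> set_pmf (X k)" "h \<in> set_pmf (insertions X \<pi> w t)"
  shows "min w t \<le> total_weight h"
  using assms(2)
proof (induction t arbitrary: h)
  case (Suc t)
  then obtain h' where h': "h' \<in> set_pmf (insertions X \<pi> w t)"
    "h \<in> set_pmf (if w \<le> total_weight h' then return_pmf h'
       else map_pmf (\<lambda>x. (\<pi> h', x) # h') (X (\<pi> h')))"
    by auto
  show ?case
  proof (cases "w \<le> total_weight h'")
    case False
    then obtain x where x: "x \<in> set_pmf (X (\<pi> h'))" "h = (\<pi> h', x) # h'"
      using h'(2) by auto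
    moreover have "x \<noteq> 0" using x(1) assms(1) by metis
    ultimately show ?thesis using Suc.IH[OF h'(1)] False by auto
  qed (use h' in auto)
qed auto

lemma insertions_stable:
  assumes "\<And>k. 0 \<notin> set_pmf (X k)" "w \<le> t"
  shows "insertions X \<pi> w t = insertions X \<pi> w w"
  using assms(2)
proof (induction t rule: dec_induct)
  case (step t)
  have "insertions X \<pi> w (Suc t) = bind_pmf (insertions X \<pi> w t) return_pmf"
    unfolding insertions.simps
    using insertions_weight[of X _ \<pi> w t, OF assms(1)] step.hyps
    by (intro bind_pmf_cong refl) (force simp: min_def)
  then show ?case using step.IH by (simp add: bind_return_pmf')
qed simp

lemma insertions_length:
  "h \<in> set_pmf (insertions X \<pi> w t) \<Longrightarrow> length h \<le> t"
proof (induction t arbitrary: h)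
  case (Suc t)
  then show ?case by (fastforce split: if_splits)
qed auto

lemma insertions_front:
  assumes "0 < w"
  shows "insertions X \<pi> w (Suc t) = bind_pmf (X (\<pi> [])) (\<lambda>x.
     map_pmf (\<lambda>h. h @ [(\<pi> [], x)]) (insertions X (\<lambda>h. \<pi> (h @ [(\<pi> [], x)])) (w - x) t))"
proof (induction t)
  case 0
  then show ?case using assms by (simp add: bind_return_pmf map_pmf_def)
next
  case (Suc t)
  have "insertions X \<pi> w (Suc (Suc t)) = bind_pmf (insertions X \<pi> w (Suc t)) (\<lambda>h.
       if w \<le> total_weight h then return_pmf h
       else map_pmf (\<lambda>x. (\<pi> h, x) # h) (X (\<pi> h)))"
    by (simp only: insertions.simps)
  also have "\<dots> = bind_pmf (X (\<pi> [])) (\<lambda>x.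
     map_pmf (\<lambda>h. h @ [(\<pi> [], x)]) (insertions X (\<lambda>h. \<pi> (h @ [(\<pi> [], x)])) (w - x) (Suc t)))"
    unfolding Suc.IH
    by (simp add: bind_assoc_pmf map_bind_pmf bind_map_pmf if_distrib[of "map_pmf _"]
        map_pmf_comp le_diff_conv cong: if_cong)
  finally show ?case .
qed

lemma abs_total_cost_le:
  fixes c :: "'i::finite \<Rightarrow> real"
  shows "\<bar>total_cost c h\<bar> \<le> real (length h) * (\<Sum>k\<in>UNIV. \<bar>c k\<bar>)"
proof (induction h)
  case (Cons e h)
  obtain k x where e: "e = (k, x)" by (cases e)
  have "\<bar>c k\<bar> \<le> (\<Sum>k\<in>UNIV. \<bar>c k\<bar>)" by (rule member_le_sum) auto
  with Cons show ?case by (simp add: e algebra_simps)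
qed simp

lemma abs_expected_cost_le:
  fixes c :: "'i::finite \<Rightarrow> real"
  shows "\<bar>expected_cost c X \<pi> w\<bar> \<le> real w * (\<Sum>k\<in>UNIV. \<bar>c k\<bar>)"
proof -
  have *: "AE h in measure_pmf (insertions X \<pi> w w).
      norm (total_cost c h) \<le> real w * (\<Sum>k\<in>UNIV. \<bar>c k\<bar>)"
  proof (rule AE_pmfI)
    fix h assume "h \<in> set_pmf (insertions X \<pi> w w)"
    then have "real (length h) \<le> real w" using insertions_length by fastforce
    then have "real (length h) * (\<Sum>k\<in>UNIV. \<bar>c k\<bar>) \<le> real w * (\<Sum>k\<in>UNIV. \<bar>c k\<bar>)"
      by (intro mult_right_mono) (auto intro: sum_nonneg)
    then show "norm (total_cost c h) \<le> real w * (\<Sum>k\<in>UNIV. \<bar>c k\<bar>)"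
      using abs_total_cost_le[of c h] by simp
  qed
  have "\<bar>expected_cost c X \<pi> w\<bar> \<le>
      measure_pmf.expectation (insertions X \<pi> w w) (\<lambda>h. norm (total_cost c h))"
    unfolding expected_cost_def using integral_norm_bound[of _ "total_cost c"] by simp
  also have "\<dots> \<le> real w * (\<Sum>k\<in>UNIV. \<bar>c k\<bar>)"
    using * by (intro measure_pmf.integral_le_const measure_pmf.integrable_const_bound[OF _ ]) auto
  finally show ?thesis .
qed

lemma bdd_below_expected_cost:
  fixes c :: "'i::finite \<Rightarrow> real"
  shows "bdd_below (range (\<lambda>\<pi>. expected_cost c X \<pi> w))"
  by (rule bdd_belowI[of _ "- (real w * (\<Sum>k\<in>UNIV. \<bar>c k\<bar>))"])
    (use abs_expected_cost_le[of c X _ w] in \<open>auto simp: abs_le_iff minus_le_iff\<close>)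

lemma OPT_le_expected_cost:
  fixes c :: "'i::finite \<Rightarrow> real"
  shows "OPT c X w \<le> expected_cost c X \<pi> w"
  unfolding OPT_def by (rule cINF_lower[OF bdd_below_expected_cost]) simp

lemma expected_cost_rec:
  fixes c :: "'i::finite \<Rightarrow> real"
  assumes X: "\<And>k. 0 \<notin> set_pmf (X k)" and w: "0 < w"
  shows "expected_cost c X \<pi> w = c (\<pi> []) +
     measure_pmf.expectation (X (\<pi> []))
       (\<lambda>x. expected_cost c X (\<lambda>h. \<pi> (h @ [(\<pi> [], x)])) (w - x))"
proof -
  define B where "B = real w * (\<Sum>k\<in>UNIV. \<bar>c k\<bar>)"
  define k where "k = \<pi> []"
  define \<rho> where "\<rho> = (\<lambda>x h. \<pi> (h @ [(k, x)]))"
  define N where "N = (\<lambda>x. map_pmf (\<lambda>h. h @ [(k, x)]) (insertions X (\<rho> x) (w - x) (w - x)))"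
  obtain t where t: "w = Suc t" using w by (cases w) auto
  have ins: "insertions X \<pi> w w = bind_pmf (X k) N"
  proof -
    have "insertions X \<pi> w w = bind_pmf (X k)
       (\<lambda>x. map_pmf (\<lambda>h. h @ [(k, x)]) (insertions X (\<rho> x) (w - x) t))"
      using insertions_front[OF w, of X \<pi> t] by (simp add: t k_def \<rho>_def)
    also have "\<dots> = bind_pmf (X k) N"
      unfolding N_def
    proof (rule bind_pmf_cong[OF refl])
      fix x assume "x \<in> set_pmf (X k)"
      then have "x \<noteq> 0" using X by metis
      then have "w - x \<le> t" using t by simp
      then show "map_pmf (\<lambda>h. h @ [(k, x)]) (insertions X (\<rho> x) (w - x) t) =
          map_pmf (\<lambda>h. h @ [(k, x)]) (insertions X (\<rho> x) (w - x) (w - x))"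
        by (simp only: insertions_stable[OF X \<open>w - x \<le> t\<close>])
    qed
    finally show ?thesis .
  qed
  define g where "g = (\<lambda>h. if \<bar>total_cost c h\<bar> \<le> B then total_cost c h else 0)"
  have gB: "\<bar>g h\<bar> \<le> B" for h
    by (auto simp: g_def B_def intro!: mult_nonneg_nonneg sum_nonneg)
  have g_eq: "g h = total_cost c h" if "h \<in> set_pmf (insertions X \<pi> w w)" for h
  proof -
    have "real (length h) \<le> real w" using insertions_length[OF that] by simp
    then have "real (length h) * (\<Sum>k\<in>UNIV. \<bar>c k\<bar>) \<le> B"
      unfolding B_def by (intro mult_right_mono) (auto intro: sum_nonneg)
    then show ?thesis using abs_total_cost_le[of c h] by (simp add: g_def)
  qed
  have "expected_cost c X \<pi> w = measure_pmf.expectation (bind_pmf (X k) N) g"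
    unfolding expected_cost_def ins[symmetric] using g_eq
    by (intro integral_cong_AE) (auto simp: AE_measure_pmf_iff)
  also have "\<dots> = measure_pmf.expectation (X k) (\<lambda>x. measure_pmf.expectation (N x) g)"
    unfolding measure_pmf_bind
  proof (rule integral_bind[where K = "count_space UNIV" and B' = 1 and B = B])
    show "g \<in> borel_measurable (count_space UNIV)" by simp
    show "\<bar>g h\<bar> \<le> B" for h by (rule gB)
    show "(\<lambda>x. measure_pmf (N x)) \<in> measurable (X k) (subprob_algebra (count_space UNIV))"
      using measurable_measure_pmf[of N] by simp
    show "finite_measure (X k)" by (rule measure_pmf.finite_measure)
    show "AE x in X k. emeasure (N x) (space (N x)) \<le> ennreal 1"
      using measure_pmf.emeasure_space_1 by simp
  qed
  also have "\<dots> = measure_pmf.expectation (X k) (\<lambda>x. c k + expected_cost c X (\<rho> x) (w - x))"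
  proof (intro integral_cong_AE, simp, simp, rule AE_pmfI)
    fix x assume x: "x \<in> set_pmf (X k)"
    have "measure_pmf.expectation (N x) g = measure_pmf.expectation (N x) (total_cost c)"
      using g_eq x by (intro integral_cong_AE) (auto simp: AE_measure_pmf_iff ins)
    also have "\<dots> = measure_pmf.expectation (insertions X (\<rho> x) (w - x) (w - x))
        (\<lambda>h. c k + total_cost c h)"
      by (simp add: N_def add.commute)
    also have "\<dots> = c k + expected_cost c X (\<rho> x) (w - x)"
    proof -
      have "integrable (insertions X (\<rho> x) (w - x) (w - x)) (total_cost c)"
      proof (rule measure_pmf.integrable_const_bound[where B = "B"])
        show "AE h in insertions X (\<rho> x) (w - x) (w - x). norm (total_cost c h) \<le> B"
        proof (rule AE_pmfI)
          fix h assume "h \<in> set_pmf (insertions X (\<rho> x) (w - x) (w - x))"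
          then have "real (length h) \<le> real w" using insertions_length by fastforce
          then have "real (length h) * (\<Sum>k\<in>UNIV. \<bar>c k\<bar>) \<le> B"
            unfolding B_def by (intro mult_right_mono) (auto intro: sum_nonneg)
          then show "norm (total_cost c h) \<le> B" using abs_total_cost_le[of c h] by simp
        qed
      qed simp
      then show ?thesis by (simp add: expected_cost_def)
    qed
    finally show "measure_pmf.expectation (N x) g = c k + expected_cost c X (\<rho> x) (w - x)" .
  qed
  also have "\<dots> = c k + measure_pmf.expectation (X k) (\<lambda>x. expected_cost c X (\<rho> x) (w - x))"
  proof -
    have "integrable (X k) (\<lambda>x. expected_cost c X (\<rho> x) (w - x))"
    proof (rule measure_pmf.integrable_const_bound[where B = B])
      have "\<bar>expected_cost c X (\<rho> x) (w - x)\<bar> \<le> B" for x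
      proof -
        have "real (w - x) * (\<Sum>k\<in>UNIV. \<bar>c k\<bar>) \<le> B"
          unfolding B_def by (intro mult_right_mono) (auto intro: sum_nonneg)
        then show ?thesis using abs_expected_cost_le[of c X "\<rho> x" "w - x"] by simp
      qed
      then show "AE x in X k. norm (expected_cost c X (\<rho> x) (w - x)) \<le> B" by simp
    qed simp
    then show ?thesis by simp
  qed
  finally show ?thesis by (simp add: k_def \<rho>_def)
qed

lemma expected_cost_0 [simp]: "expected_cost c X \<pi> 0 = 0"
  by (simp add: expected_cost_def)

lemma OPT_0: "OPT c X 0 = 0"
  by (simp add: OPT_def)

lemma expectation_remaining:
  fixes F :: "nat \<Rightarrow> nat \<Rightarrow> real"
  assumes "0 \<notin> set_pmf p" "\<And>x. F x 0 = 0"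
  shows "measure_pmf.expectation p (\<lambda>x. F x (w - x)) = (\<Sum>j=1..w. pmf p j * F j (w - j))"
proof -
  have "measure_pmf.expectation p (\<lambda>x. F x (w - x)) = (\<Sum>j=1..w. F j (w - j) * pmf p j)"
  proof (rule integral_measure_pmf_real)
    fix x assume x: "x \<in> set_pmf p" "F x (w - x) \<noteq> 0"
    then have "x \<noteq> 0" using assms(1) by metis
    moreover have "x \<le> w" using x(2) assms(2)[of x] by (cases "x \<le> w") auto
    ultimately show "x \<in> {1..w}" by simp
  qed simp
  then show ?thesis by (simp add: mult.commute)
qed

lemma OPT_rec:
  fixes c :: "'i::finite \<Rightarrow> real"
  assumes X: "\<And>k. 0 \<notin> set_pmf (X k)" and w: "0 < w"
  shows "OPT c X w = (MIN k. c k + (\<Sum>j=1..w. pmf (X k) j * OPT c X (w - j)))"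
proof (rule antisym)
  let ?R = "\<lambda>k. c k + (\<Sum>j=1..w. pmf (X k) j * OPT c X (w - j))"
  have rec: "expected_cost c X \<pi> w = c (\<pi> []) + (\<Sum>j=1..w. pmf (X (\<pi> [])) j *
      expected_cost c X (\<lambda>h. \<pi> (h @ [(\<pi> [], j)])) (w - j))" for \<pi>
    unfolding expected_cost_rec[of X, OF X w]
    using expectation_remaining[of "X (\<pi> [])"
        "\<lambda>x. expected_cost c X (\<lambda>h. \<pi> (h @ [(\<pi> [], x)]))" w] X
    by simp
  show "OPT c X w \<le> Min (range ?R)"
  proof (rule Min.boundedI)
    fix y assume "y \<in> range ?R"
    then obtain k where y: "y = ?R k" by blast
    show "OPT c X w \<le> y"
    proof (rule field_le_epsilon)
      fix e :: real assume e: "0 < e"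
      have "\<exists>\<rho>. expected_cost c X \<rho> v < OPT c X v + e" for v
        using cINF_less_iff[OF _ bdd_below_expected_cost[of c X v], of "OPT c X v + e"] e
        unfolding OPT_def by auto
      then obtain \<rho> where \<rho>: "\<And>v. expected_cost c X (\<rho> v) v < OPT c X v + e" by metis
      define \<pi> where "\<pi> = (\<lambda>h. if h = [] then k else \<rho> (w - snd (last h)) (butlast h))"
      have "OPT c X w \<le> expected_cost c X \<pi> w" by (rule OPT_le_expected_cost)
      also have "\<dots> = c k + (\<Sum>j=1..w. pmf (X k) j * expected_cost c X (\<rho> (w - j)) (w - j))"
        unfolding rec by (simp add: \<pi>_def)
      also have "\<dots> \<le> c k + (\<Sum>j=1..w. pmf (X k) j * (OPT c X (w - j) + e))"
        using \<rho> by (intro add_left_mono sum_mono mult_left_mono) (auto intro: less_imp_le)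
      also have "\<dots> = y + (\<Sum>j=1..w. pmf (X k) j) * e"
        by (simp add: y algebra_simps sum.distrib sum_distrib_left)
      also have "\<dots> \<le> y + 1 * e"
        using e measure_pmf.prob_le_1[of "X k" "{1..w}"]
        by (intro add_left_mono mult_right_mono) (auto simp: measure_measure_pmf_finite)
      finally show "OPT c X w \<le> y + e" by simp
    qed
  qed auto
  show "Min (range ?R) \<le> OPT c X w"
    unfolding OPT_def[of c X w]
  proof (rule cINF_greatest)
    fix \<pi> :: "'i policy"
    have "Min (range ?R) \<le> ?R (\<pi> [])" by (rule Min_le) auto
    also have "\<dots> \<le> expected_cost c X \<pi> w"
      unfolding rec by (intro add_left_mono sum_mono mult_left_mono OPT_le_expected_cost) auto
    finally show "Min (range ?R) \<le> expected_cost c X \<pi> w" .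
  qed simp
qed

end

theory Submission
  imports Defs
begin

text \<open>
  Write \<open>f\<^sub>i\<close> for the thresholds, \<open>s = \<delta> T\<close> and \<open>e = \<epsilon> / 10\<close>.

  Upper bound: the rounded value \<open>g\<close> is nondecreasing, so the search criterion that defines
  \<open>f\<^sub>i\<close> holds at every \<open>w \<le> f\<^sub>i\<close>, not only at \<open>f\<^sub>i\<close> itself. Induction on \<open>i\<close> and \<open>w\<close> then gives
  \<open>OPT w \<le> i s\<close> whenever \<open>w \<le> f\<^sub>i\<close>.

  Lower bound: rounding costs at most \<open>s\<close> per inserted item, and \<open>s = \<theta> T e \<le> e c\<^sub>k\<close> because every
  item is expensive. Hence rounding is paid for by inflating all costs by the factor \<open>1 + e\<close>, and
  \<open>i s < (1 + e) OPT w\<close> whenever \<open>f\<^sub>i < w \<le> W\<close>. This forces termination, and for the output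
  \<open>V = i s\<close> it gives \<open>V - s \<le> (1 + e) OPT W\<close>. Finally \<open>s = \<delta> T \<le> \<delta> V\<close>, since \<open>T \<le> OPT W \<le> V\<close>,
  and \<open>(1 - e) (1 + e) \<le> 1\<close>.
\<close>

section \<open>Rounding along a list of thresholds\<close>

text \<open>\<open>F\<close> need not be sorted: the least index whose entry reaches
  \<open>w\<close> works, and \<open>F ! 0 = 0 < w\<close> keeps it away from 0.\<close>

lemma threshold_index_exists:
  fixes F :: "nat list"
  assumes "F ! 0 = 0" "0 < w" "w \<le> F ! m" "m < length F"
  obtains j where "1 \<le> j" "j \<le> m" "F ! (j - 1) < w" "w \<le> F ! j"
proof -
  define j where "j = (LEAST j. w \<le> F ! j)"
  have j: "w \<le> F ! j" and "j \<le> m"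
    using assms(3) unfolding j_def by (auto intro: LeastI Least_le)
  moreover have "1 \<le> j" using j assms(1,2) by (cases j) auto
  moreover have "F ! (j - 1) < w"
    using not_less_Least[of "j - 1" "\<lambda>j. w \<le> F ! j"] \<open>1 \<le> j\<close> by (simp add: j_def[symmetric])
  ultimately show ?thesis using that by blast
qed

text \<open>The last clause of \<open>below\<close> exceeds plain minimality of the
  \<open>LEAST\<close>: it does not ask for \<open>F ! (l - 1) < w\<close>. This yields monotonicity
  without knowing that \<open>F\<close> is sorted.\<close>

lemma rounded_value_cases:
  assumes F: "F \<noteq> []" "F ! 0 = 0" and w: "0 < w"
  obtains (above) "last F < w" "rounded_value s F w = real (length F) * s"
  | (below) j where "w \<le> last F" "1 \<le> j" "j < length F" "F ! (j - 1) < w" "w \<le> F ! j"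
      "rounded_value s F w = real j * s"
      "\<And>l. 1 \<le> l \<Longrightarrow> l < length F \<Longrightarrow> w \<le> F ! l \<Longrightarrow> j \<le> l"
proof (cases "last F < w")
  case True
  then show ?thesis by (intro above) (auto simp: rounded_value_def)
next
  case False
  define P where "P = (\<lambda>j. 1 \<le> j \<and> j < length F \<and> F ! (j - 1) < w \<and> w \<le> F ! j)"
  have ex: "\<exists>j\<le>l. P j" if l: "l < length F" "w \<le> F ! l" for l
  proof -
    obtain j where "1 \<le> j" "j \<le> l" "F ! (j - 1) < w" "w \<le> F ! j"
      using threshold_index_exists[OF F(2) w l(2,1)] .
    with l(1) show ?thesis by (auto simp: P_def)
  qed
  have "\<exists>j. P j" using ex[of "length F - 1"] F(1) False by (auto simp: last_conv_nth)
  then have "P (Least P)" by (rule LeastI_ex)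
  moreover have "Least P \<le> l" if "l < length F" "w \<le> F ! l" for l
    using ex[OF that] by (auto intro: order_trans[OF Least_le])
  ultimately show ?thesis
    using False by (intro below[of "Least P"]) (auto simp: P_def rounded_value_def)
qed

lemma rounded_value_nonneg: "0 \<le> s \<Longrightarrow> 0 \<le> rounded_value s F w"
  by (simp add: rounded_value_def)

lemma rounded_value_mono:
  assumes F: "F \<noteq> []" "F ! 0 = 0" and w: "0 < w" "w \<le> w'" and s: "0 \<le> s"
  shows "rounded_value s F w \<le> rounded_value s F w'"
  using F w(1)
proof (cases rule: rounded_value_cases[where s = s])
  case above
  then show ?thesis using w by (simp add: rounded_value_def)
next
  case (below j)
  note j = below
  have "0 < w'" using w by simp
  with F show ?thesis
  proof (cases rule: rounded_value_cases[where s = s])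
    case above
    then show ?thesis using j s by (simp add: mult_right_mono)
  next
    case (below j')
    \<comment> \<open>The entry at \<open>j'\<close> reaches \<open>w'\<close>, hence also
      \<open>w\<close>, so it competes with \<open>j\<close>.\<close>
    then have "j \<le> j'" using j(7)[of j'] w by simp
    then show ?thesis using j(6) below(6) s by (simp add: mult_right_mono)
  qed
qed

section \<open>Convolutions with a weight distribution\<close>

lemma convolution_reindex:
  fixes p g :: "nat \<Rightarrow> real"
  shows "(\<Sum>j\<in>{1..<w}. p (w - j) * g j) = (\<Sum>j\<in>{1..<w}. p j * g (w - j))"
  by (rule sum.reindex_bij_witness[of _ "\<lambda>j. w - j" "\<lambda>j. w - j"]) auto

text \<open>After reindexing, the factors \<open>p j\<close> are the same on both sides, so the sums
  compare termwise and the longer one only gains nonnegative terms. Monotonicity of \<open>g\<close>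
  is asked for at positive arguments only, because at 0 no index satisfies the condition in
  \<open>rounded_value\<close>.\<close>

lemma convolution_mono:
  fixes p g :: "nat \<Rightarrow> real"
  assumes "\<And>j. 0 \<le> p j" "\<And>j. 0 \<le> g j" "\<And>u v. 0 < u \<Longrightarrow> u \<le> v \<Longrightarrow> g u \<le> g v" "w \<le> w'"
  shows "(\<Sum>j\<in>{1..<w}. p (w - j) * g j) \<le> (\<Sum>j\<in>{1..<w'}. p (w' - j) * g j)"
proof -
  have "(\<Sum>j\<in>{1..<w}. p j * g (w - j)) \<le> (\<Sum>j\<in>{1..<w}. p j * g (w' - j))"
    using assms by (intro sum_mono mult_left_mono) auto
  also have "\<dots> \<le> (\<Sum>j\<in>{1..<w'}. p j * g (w' - j))"
    using assms by (intro sum_mono2) auto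
  finally show ?thesis unfolding convolution_reindex[of p w g] convolution_reindex[of p w' g] .
qed

section \<open>Thresholds and their search criterion\<close>

lemma length_thresholds [simp]: "length (thresholds c X W s i) = Suc i"
  by (induction i) auto

lemma thresholds_nonempty [simp]: "thresholds c X W s i \<noteq> []"
  by (metis length_thresholds length_0_conv nat.distinct(1))

lemma nth_thresholds: "j \<le> i \<Longrightarrow> thresholds c X W s i ! j = threshold c X W s j"
proof (induction i)
  case (Suc i)
  then show ?case
    by (cases "j = Suc i") (auto simp: threshold_def nth_append)
qed (simp add: threshold_def)

lemma nth_thresholds_0 [simp]: "thresholds c X W s i ! 0 = 0"
  by (simp add: nth_thresholds threshold_def)

lemma threshold_Suc:
  "threshold c X W s (Suc i) = next_threshold c X W s (thresholds c X W s i)"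
  by (simp add: threshold_def)

definition fits :: "('i \<Rightarrow> real) \<Rightarrow> ('i \<Rightarrow> nat pmf) \<Rightarrow> real \<Rightarrow> nat list \<Rightarrow> nat \<Rightarrow> bool" where
  "fits c X s F w \<longleftrightarrow>
     (\<exists>k. c k + (\<Sum>j\<in>{1..<w}. pmf (X k) (w - j) * rounded_value s F j) \<le> real (length F) * s)"

text \<open>The same type \<open>k\<close> serves for \<open>w\<close>, since only the convolution
  depends on the capacity. This is also what makes binary search sound.\<close>

lemma fits_antimono:
  assumes "fits c X s F w'" "w \<le> w'" "F \<noteq> []" "F ! 0 = 0" "0 \<le> s"
  shows "fits c X s F w"
proof -
  obtain k where k: "c k + (\<Sum>j\<in>{1..<w'}. pmf (X k) (w' - j) * rounded_value s F j)
      \<le> real (length F) * s"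
    using assms(1) by (auto simp: fits_def)
  have "(\<Sum>j\<in>{1..<w}. pmf (X k) (w - j) * rounded_value s F j)
      \<le> (\<Sum>j\<in>{1..<w'}. pmf (X k) (w' - j) * rounded_value s F j)"
    using assms by (intro convolution_mono rounded_value_nonneg rounded_value_mono) auto
  with k show ?thesis by (auto simp: fits_def intro!: exI[of _ k])
qed

lemma next_threshold_eq: "next_threshold c X W s F = Max (insert 0 {w \<in> {0..W}. fits c X s F w})"
  by (simp add: next_threshold_def fits_def)

lemma fits_if_le_next_threshold:
  assumes "0 < w" "w \<le> next_threshold c X W s F" "F \<noteq> []" "F ! 0 = 0" "0 \<le> s"
  shows "fits c X s F w"
proof -
  have "next_threshold c X W s F \<in> insert 0 {w \<in> {0..W}. fits c X s F w}"
    unfolding next_threshold_eq by (rule Max_in) auto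
  \<comment> \<open>The threshold is at least \<open>w > 0\<close>, so it is not the default
    0.\<close>
  then have "fits c X s F (next_threshold c X W s F)" using assms(1,2) by auto
  then show ?thesis by (rule fits_antimono) (use assms in auto)
qed

lemma not_fits_if_next_threshold_less:
  assumes "next_threshold c X W s F < w" "w \<le> W"
  shows "\<not> fits c X s F w"
proof
  assume "fits c X s F w"
  then have "w \<le> next_threshold c X W s F"
    unfolding next_threshold_eq using assms(2) by (intro Max_ge) auto
  with assms(1) show False by simp
qed

section \<open>The optimum as a convolution recursion\<close>

text \<open>The term \<open>j = w\<close> vanishes because \<open>OPT\<close> is 0 at capacity 0;
  what remains has the shape of the search criterion.\<close>

lemma OPT_rec_convolution:
  fixes c :: "'i::finite \<Rightarrow> real"
  assumes X: "\<And>k. 0 \<notin> set_pmf (X k)" and w: "0 < w"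
  shows "OPT c X w = (MIN k. c k + (\<Sum>j\<in>{1..<w}. pmf (X k) (w - j) * OPT c X j))"
proof -
  have "(\<Sum>j=1..w. pmf (X k) j * OPT c X (w - j)) =
      (\<Sum>j\<in>{1..<w}. pmf (X k) j * OPT c X (w - j))" for k
    using w by (intro sum.mono_neutral_right) (auto simp: OPT_0)
  then show ?thesis
    using OPT_rec[of X w c, OF X w] convolution_reindex[of _ w "OPT c X"] by simp
qed

lemma OPT_le:
  fixes c :: "'i::finite \<Rightarrow> real"
  assumes "\<And>k. 0 \<notin> set_pmf (X k)" "0 < w"
  shows "OPT c X w \<le> c k + (\<Sum>j\<in>{1..<w}. pmf (X k) (w - j) * OPT c X j)"
  unfolding OPT_rec_convolution[of X w c, OF assms] by (rule Min_le) auto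

lemma OPT_attained:
  fixes c :: "'i::finite \<Rightarrow> real"
  assumes "\<And>k. 0 \<notin> set_pmf (X k)" "0 < w"
  obtains k where "OPT c X w = c k + (\<Sum>j\<in>{1..<w}. pmf (X k) (w - j) * OPT c X j)"
proof -
  have "OPT c X w \<in> range (\<lambda>k. c k + (\<Sum>j\<in>{1..<w}. pmf (X k) (w - j) * OPT c X j))"
    unfolding OPT_rec_convolution[of X w c, OF assms] by (rule Min_in) auto
  then show ?thesis using that by blast
qed

lemma OPT_nonneg:
  fixes c :: "'i::finite \<Rightarrow> real"
  assumes X: "\<And>k. 0 \<notin> set_pmf (X k)" and c: "\<And>k. 0 \<le> c k"
  shows "0 \<le> OPT c X w"
proof (induction w rule: less_induct)
  case (less w)
  show ?case
  proof (cases "w = 0")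
    case False
    then obtain k where "OPT c X w = c k + (\<Sum>j\<in>{1..<w}. pmf (X k) (w - j) * OPT c X j)"
      using OPT_attained[of X w c, OF X] by blast
    also have "\<dots> \<ge> 0" using less c by (intro add_nonneg_nonneg sum_nonneg mult_nonneg_nonneg) auto
    finally show ?thesis .
  qed (simp add: OPT_0)
qed

section \<open>Comparing the optimum with the thresholds\<close>

text \<open>Two nested inductions: capacities up to the last known threshold are covered by smaller
  \<open>i\<close>; above it the rounded value is \<open>i * s\<close> itself, so the claim at the
  same \<open>i\<close> for smaller capacities is needed.\<close>

lemma OPT_le_of_le_threshold:
  fixes c :: "'i::finite \<Rightarrow> real"
  assumes X: "\<And>k. 0 \<notin> set_pmf (X k)" and s: "0 \<le> s"
  shows "w \<le> threshold c X W s i \<Longrightarrow> OPT c X w \<le> real i * s"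
proof (induction i arbitrary: w rule: less_induct)
  case (less i)
  note IH_i = less.IH
  from less.prems show ?case
  proof (induction w rule: less_induct)
    case (less w)
    show ?case
    proof (cases "w = 0")
      case True
      then show ?thesis using s by (simp add: OPT_0)
    next
      case False
      with less.prems obtain i' where i: "i = Suc i'" by (cases i) (auto simp: threshold_def)
      define F where "F = thresholds c X W s i'"
      have F: "F \<noteq> []" "F ! 0 = 0" "length F = i" by (simp_all add: F_def i)
      have "fits c X s F w"
        using less.prems False F s
        by (intro fits_if_le_next_threshold) (auto simp: i threshold_Suc F_def)
      then obtain k where k: "c k + (\<Sum>j\<in>{1..<w}. pmf (X k) (w - j) * rounded_value s F j)
          \<le> real i * s"
        by (auto simp: fits_def F(3))
      have g: "OPT c X j \<le> rounded_value s F j" if j: "j \<in> {1..<w}" for j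
      proof -
        have "0 < j" using j by simp
        with F(1,2) show ?thesis
        proof (cases rule: rounded_value_cases[where s = s])
          case above
          then show ?thesis using less.IH[of j] less.prems j F(3) by simp
        next
          case (below l)
          then show ?thesis using IH_i[of l j] F(3) by (simp add: F_def i nth_thresholds)
        qed
      qed
      have "OPT c X w \<le> c k + (\<Sum>j\<in>{1..<w}. pmf (X k) (w - j) * OPT c X j)"
        using False by (intro OPT_le X) auto
      also have "\<dots> \<le> c k + (\<Sum>j\<in>{1..<w}. pmf (X k) (w - j) * rounded_value s F j)"
        using g by (intro add_left_mono sum_mono mult_left_mono) auto
      finally show ?thesis using k by simp
    qed
  qed
qed

text \<open>Induction on \<open>i\<close> alone suffices: giving up one \<open>s\<close> moves each
  rounded value down to an earlier level, whose threshold lies below the capacity. Strictness comes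
  from the failed search.\<close>

lemma OPT_gt_of_threshold_less:
  fixes c :: "'i::finite \<Rightarrow> real"
  assumes X: "\<And>k. 0 \<notin> set_pmf (X k)" and s: "0 \<le> s" and e: "0 \<le> e"
    and c: "\<And>k. 0 \<le> c k" "\<And>k. s \<le> e * c k"
  shows "0 < i \<Longrightarrow> threshold c X W s i < w \<Longrightarrow> w \<le> W \<Longrightarrow> real i * s < (1 + e) * OPT c X w"
proof (induction i arbitrary: w rule: less_induct)
  case (less i)
  obtain i' where i: "i = Suc i'" using less.prems by (cases i) auto
  define F where "F = thresholds c X W s i'"
  have F: "F \<noteq> []" "F ! 0 = 0" "length F = i" "last F = threshold c X W s i'"
    by (simp_all add: F_def i threshold_def)
  have "\<not> fits c X s F w"
    using less.prems by (intro not_fits_if_next_threshold_less) (auto simp: i threshold_Suc F_def)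
  then have k: "real i * s < c k + (\<Sum>j\<in>{1..<w}. pmf (X k) (w - j) * rounded_value s F j)" for k
    by (auto simp: fits_def F(3) not_le)
  \<comment> \<open>Only the weak inequality survives at level 0, where it is nonnegativity of the
    optimum.\<close>
  have lower: "real l * s \<le> (1 + e) * OPT c X j"
    if "l < i" "threshold c X W s l < j" "j \<le> W" for l j
  proof (cases "l = 0")
    case True
    then show ?thesis using OPT_nonneg[of X c j, OF X c(1)] e by simp
  next
    case False
    then show ?thesis using less.IH[of l j] that by simp
  qed
  have g: "rounded_value s F j \<le> (1 + e) * OPT c X j + s" if j: "j \<in> {1..<w}" for j
  proof -
    have "0 < j" using j by simp
    with F(1,2) show ?thesis
    proof (cases rule: rounded_value_cases[where s = s])
      case above
      then show ?thesis
        using lower[of i' j] less.prems j F by (simp add: i algebra_simps)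
    next
      case (below l)
      then have "real (l - 1) * s \<le> (1 + e) * OPT c X j"
        using lower[of "l - 1" j] less.prems j F(3) by (simp add: F_def i nth_thresholds)
      then show ?thesis using below by (simp add: algebra_simps)
    qed
  qed
  have "0 < w" using less.prems by simp
  then obtain k where OPT: "OPT c X w = c k + (\<Sum>j\<in>{1..<w}. pmf (X k) (w - j) * OPT c X j)"
    using OPT_attained[of X w c, OF X] by blast
  \<comment> \<open>A probability, so one insertion loses at most \<open>s\<close> to rounding in
    expectation.\<close>
  have mass: "(\<Sum>j\<in>{1..<w}. pmf (X k) (w - j)) \<le> 1"
    using convolution_reindex[of "pmf (X k)" w "\<lambda>_. 1"] measure_pmf.prob_le_1[of "X k" "{1..<w}"]
    by (simp add: measure_measure_pmf_finite)
  have "real i * s < c k + (\<Sum>j\<in>{1..<w}. pmf (X k) (w - j) * rounded_value s F j)" by (rule k)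
  also have "\<dots> \<le> c k + (\<Sum>j\<in>{1..<w}. pmf (X k) (w - j) * ((1 + e) * OPT c X j + s))"
    using g by (intro add_left_mono sum_mono mult_left_mono) auto
  also have "\<dots> = c k + (1 + e) * (\<Sum>j\<in>{1..<w}. pmf (X k) (w - j) * OPT c X j)
      + (\<Sum>j\<in>{1..<w}. pmf (X k) (w - j)) * s"
    by (simp add: algebra_simps sum.distrib sum_distrib_left sum_distrib_right)
  also have "\<dots> \<le> c k + (1 + e) * (\<Sum>j\<in>{1..<w}. pmf (X k) (w - j) * OPT c X j) + e * c k"
    using mult_right_mono[OF mass s] c(2)[of k] by simp
  also have "\<dots> = (1 + e) * OPT c X w" unfolding OPT by (simp add: algebra_simps)
  finally show ?case .
qed

text \<open>The first conjunct is conditional: \<open>nat \<lceil>1 / \<delta>\<rceil> + 1\<close>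
  rounds reach at most \<open>(1 + 2 * \<delta>) * T\<close>, which can stay below the optimum when
  \<open>T\<close> is near a quarter of it. The second conjunct gives termination for a long enough
  loop.\<close>

theorem theorem3:
  fixes c :: "'i::finite \<Rightarrow> real"
    and X :: "'i \<Rightarrow> nat pmf"
    and W :: nat
    and \<epsilon> \<theta> \<delta> T :: real
  assumes pos_weights: "\<And>k. 0 \<notin> set_pmf (X k)"
    and eps: "0 < \<epsilon>"
    and theta: "\<theta> = \<epsilon> / (10 * real CARD('i))"
    and delta: "\<delta> = \<epsilon>\<^sup>2 / (100 * real CARD('i))"
    and delta_le_1: "\<delta> \<le> 1"
    and estimate: "1 / 4 * OPT c X W \<le> T" "T \<le> OPT c X W"
    and expensive: "\<And>k. \<theta> * T \<le> c k"
  shows "(\<forall>V. dp_output c X W (\<delta> * T) (nat \<lceil>1 / \<delta>\<rceil> + 1) = Some V \<longrightarrow>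
            (1 - \<delta>) * (1 - \<epsilon> / 10) * V \<le> OPT c X W \<and> OPT c X W \<le> V) \<and>
         (\<exists>N\<^sub>0. \<forall>N\<ge>N\<^sub>0. \<exists>V. dp_output c X W (\<delta> * T) N = Some V \<and>
            (1 - \<delta>) * (1 - \<epsilon> / 10) * V \<le> OPT c X W \<and> OPT c X W \<le> V)"
proof -
  define s where "s = \<delta> * T"
  define e where "e = \<epsilon> / 10"
  define f where "f = threshold c X W s"
  have \<delta>: "0 < \<delta>" "\<delta> = e * \<theta>" and e: "0 < e" and "0 < \<theta>"
    using eps by (simp_all add: delta theta e_def power2_eq_square)
  have T: "0 \<le> T" using estimate by linarith
  then have s: "0 \<le> s" using \<delta> by (simp add: s_def)
  have "0 \<le> \<theta> * T" using T \<open>0 < \<theta>\<close> by simp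
  then have c: "0 \<le> c k" for k using expensive[of k] by linarith
  have sc: "s \<le> e * c k" for k
    using mult_left_mono[OF expensive[of k], of e] e by (simp add: s_def \<delta>(2) mult.assoc)
  have opt: "0 \<le> OPT c X W" using OPT_nonneg[of X c W, OF pos_weights c] .
  have upper: "OPT c X W \<le> real i * s" if "W \<le> f i" for i
    using OPT_le_of_le_threshold[of X s W c W i, OF pos_weights s] that by (simp add: f_def)
  have lower: "real i * s < (1 + e) * OPT c X W" if "0 < i" "f i < W" for i
    using OPT_gt_of_threshold_less[of X s e c i W W, OF pos_weights s _ c sc] that e
    by (simp add: f_def)
  have bounds: "(1 - \<delta>) * (1 - e) * (real i * s) \<le> OPT c X W \<and> OPT c X W \<le> real i * s"
    if i: "i = (LEAST i. 1 \<le> i \<and> W \<le> f i)" "\<exists>i. 1 \<le> i \<and> W \<le> f i" for i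
  proof
    have i1: "1 \<le> i" "W \<le> f i" using LeastI_ex[OF i(2)] i(1) by auto
    show up: "OPT c X W \<le> real i * s" using upper i1 by simp
    have low: "real (i - 1) * s \<le> (1 + e) * OPT c X W"
    \<comment> \<open>For \<open>i = 1\<close> there is no failed earlier round, but the left side
      is 0.\<close>
    proof (cases "i = 1")
      case False
      then have "\<not> W \<le> f (i - 1)"
        using not_less_Least[of "i - 1" "\<lambda>i. 1 \<le> i \<and> W \<le> f i"] i(1) i1 by auto
      then show ?thesis using lower[of "i - 1"] i1 False by simp
    qed (use opt e in simp)
    \<comment> \<open>This is \<open>T \<le> OPT c X W \<le> real i * s\<close>, scaled by
      \<open>\<delta>\<close>.\<close>
    have "s \<le> \<delta> * (real i * s)"
      unfolding s_def using estimate(2) up \<delta> by (intro mult_left_mono) (auto simp: s_def)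
    then have step: "(1 - \<delta>) * (real i * s) \<le> (1 + e) * OPT c X W"
      using low i1 by (simp add: algebra_simps)
    show "(1 - \<delta>) * (1 - e) * (real i * s) \<le> OPT c X W"
    proof (cases "e \<le> 1")
      case True
      then have "(1 - e) * ((1 - \<delta>) * (real i * s)) \<le> (1 - e) * ((1 + e) * OPT c X W)"
        using step by (intro mult_left_mono) auto
      also have "\<dots> = OPT c X W - e\<^sup>2 * OPT c X W"
        by (simp add: algebra_simps power2_eq_square)
      also have "\<dots> \<le> OPT c X W" using opt by simp
      finally show ?thesis by (simp add: mult_ac)
    next
      \<comment> \<open>For \<open>e > 1\<close> the lower bound is trivial: its left side is
        nonpositive, as \<open>\<delta> \<le> 1\<close>.\<close>
      case False
      then have "(1 - e) * ((1 - \<delta>) * (real i * s)) \<le> 0"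
        using delta_le_1 s by (intro mult_nonpos_nonneg mult_nonneg_nonneg) auto
      then show ?thesis using opt by (simp add: mult_ac)
    qed
  qed
  \<comment> \<open>Otherwise all multiples of \<open>s\<close> stay below a fixed bound. If
    \<open>s = 0\<close>, then \<open>T = 0\<close>, and the lower estimate
    \<open>OPT c X W / 4 \<le> T\<close> forces the optimum to 0, against strictness.\<close>
  have terminates: "\<exists>i\<ge>1. W \<le> f i"
  proof (rule ccontr)
    assume "\<not> ?thesis"
    then have "f i < W" if "1 \<le> i" for i using that by (meson not_le)
    then have *: "real i * s < (1 + e) * OPT c X W" if "1 \<le> i" for i
      using lower[of i] that by simp
    show False
    proof (cases "s = 0")
      case True
      then have "T = 0" using \<delta>(1) by (simp add: s_def)
      then have "OPT c X W = 0" using estimate opt by linarith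
      then show False using *[of 1] True by simp
    next
      case False
      then obtain n where "(1 + e) * OPT c X W < real n * s"
        using reals_Archimedean3[of s] s by fastforce
      moreover have "real n * s \<le> real (Suc n) * s" using s by (intro mult_right_mono) auto
      ultimately show False using *[of "Suc n"] by simp
    qed
  qed
  define I where "I = (LEAST i. 1 \<le> i \<and> W \<le> f i)"
  have out: "dp_output c X W s N =
      (if \<exists>i\<in>{1..N}. W \<le> f i then Some (real I * s) else None)" for N
    by (simp add: dp_output_def f_def I_def)
  have good: "(1 - \<delta>) * (1 - e) * (real I * s) \<le> OPT c X W \<and> OPT c X W \<le> real I * s"
    using bounds[OF I_def] terminates by blast
  obtain N\<^sub>0 where "1 \<le> N\<^sub>0" "W \<le> f N\<^sub>0" using terminates by blast
  then have "dp_output c X W s N = Some (real I * s)" if "N\<^sub>0 \<le> N" for N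
    using that by (auto simp: out)
  with good show ?thesis
    unfolding s_def[symmetric] e_def[symmetric]
    by (intro conjI allI impI exI[of _ N\<^sub>0]) (auto simp: out split: if_splits)
qed

end
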